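(* Let $n\ge 1$, let $\alpha_1,\ldots,\alpha_n$ be positive real algebraic numbers, and let $S=\mathbb{N}_0[\alpha_1,\ldots,\alpha_n]\subseteq\mathbb{R}_{\ge 0}$. If $S$ is bi-UFS, then $S=\mathbb{N}_0$.
   Context: $\mathbb{N}_0$ denotes the nonnegative integers and $\mathbb{N}_0[\alpha_1,\ldots,\alpha_n]=\{f(\alpha_1,\ldots,\alpha_n): f\in\mathbb{N}_0[x_1,\ldots,x_n]\}$. All monoids are commutative and cancellative. A nonunit $a$ of a monoid $M$ is an atom if $a=xy$ with $x,y\in M$ forces $x$ or $y$ to be a unit. A monoid is a unique factorization monoid (UFM) if every nonunit factors into finitely many atoms, uniquely up to order and multiplication by units. A positive semidomain is a subset $S\subseteq\mathbb{R}_{\ge 0}$ containing $0$ and $1$ and closed under addition and multiplication; put $S^*=S\setminus\{0\}$. $S$ is bi-UFS if both the additive monoid $(S,+)$ and the multiplicative monoid $(S^*,\cdot)$ are UFMs. *)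

theory Defs
  imports
    "HOL-Algebra.Divisibility"
    "HOL-Library.Poly_Mapping"
    "HOL-Computational_Algebra.Polynomial"
begin

section \<open>Positive semidomains and the bi-UFS property\<close>

definition positive_semidomain :: "real set \<Rightarrow> bool" where
  "positive_semidomain S \<longleftrightarrow>
     S \<subseteq> {0..} \<and> 0 \<in> S \<and> 1 \<in> S \<and>
     (\<forall>x\<in>S. \<forall>y\<in>S. x + y \<in> S) \<and> (\<forall>x\<in>S. \<forall>y\<in>S. x * y \<in> S)"

definition additive_monoid :: "real set \<Rightarrow> real monoid" where
  "additive_monoid S = \<lparr>carrier = S, mult = (+), one = 0\<rparr>"

definition multiplicative_monoid :: "real set \<Rightarrow> real monoid" where
  "multiplicative_monoid S = \<lparr>carrier = S - {0}, mult = (*), one = 1\<rparr>"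

text \<open>
  Unique factorization monoids are the library's \<^const>\<open>factorial_monoid\<close>. Its
  \<^const>\<open>Divisibility.irreducible\<close> is phrased with proper factors; on the carrier of a commutative
  cancellative monoid it is the usual notion of an atom.
\<close>

lemma (in comm_monoid_cancel) irreducible_iff_atom:
  assumes "a \<in> carrier G"
  shows "Divisibility.irreducible G a \<longleftrightarrow>
    a \<notin> Units G \<and>
    (\<forall>x\<in>carrier G. \<forall>y\<in>carrier G. a = x \<otimes> y \<longrightarrow> x \<in> Units G \<or> y \<in> Units G)"
proof (intro iffI conjI ballI impI)
  assume irr: "Divisibility.irreducible G a"
  then show "a \<notin> Units G" by (simp add: Divisibility.irreducible_def)
  fix x y assume xy: "x \<in> carrier G" "y \<in> carrier G" "a = x \<otimes> y"
  show "x \<in> Units G \<or> y \<in> Units G"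
    using irreducible_prodE[of x y] irr xy by blast
next
  assume *: "a \<notin> Units G \<and>
    (\<forall>x\<in>carrier G. \<forall>y\<in>carrier G. a = x \<otimes> y \<longrightarrow> x \<in> Units G \<or> y \<in> Units G)"
  show "Divisibility.irreducible G a"
  proof (rule Divisibility.irreducibleI)
    show "a \<notin> Units G" using * by blast
    fix b assume b: "b \<in> carrier G" "properfactor G b a"
    then obtain c where c: "c \<in> carrier G" "a = b \<otimes> c"
      unfolding properfactor_def factor_def by blast
    have "c \<notin> Units G"
    proof
      assume "c \<in> Units G"
      then have "b \<sim> a" using c b(1) by (metis associatedI2' associated_sym)
      then show False using b(2) by (simp add: properfactor_def associated_def)
    qed
    then show "b \<in> Units G" using * b(1) c by blast
  qed
qed

definition bi_UFS :: "real set \<Rightarrow> bool" where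
  "bi_UFS S \<longleftrightarrow>
     positive_semidomain S \<and>
     factorial_monoid (additive_monoid S) \<and>
     factorial_monoid (multiplicative_monoid S)"


section \<open>The semiring of values of polynomials with natural coefficients\<close>

text \<open>
  A polynomial is a finitely supported map from monomials to coefficients, a monomial being
  a finitely supported map from indices of variables to exponents. Polynomials in
  $x_1, \ldots, x_n$ are those all of whose monomials are supported in \<open>{1..n}\<close>.
\<close>

definition nat_mpoly_in :: "nat set \<Rightarrow> ((nat \<Rightarrow>\<^sub>0 nat) \<Rightarrow>\<^sub>0 nat) set" where
  "nat_mpoly_in I = {f. \<forall>m\<in>Poly_Mapping.keys f. Poly_Mapping.keys m \<subseteq> I}"

definition monom_eval :: "(nat \<Rightarrow> real) \<Rightarrow> (nat \<Rightarrow>\<^sub>0 nat) \<Rightarrow> real" where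
  "monom_eval \<alpha> m = (\<Prod>i\<in>Poly_Mapping.keys m. \<alpha> i ^ Poly_Mapping.lookup m i)"

definition nat_mpoly_eval :: "(nat \<Rightarrow> real) \<Rightarrow> ((nat \<Rightarrow>\<^sub>0 nat) \<Rightarrow>\<^sub>0 nat) \<Rightarrow> real" where
  "nat_mpoly_eval \<alpha> f =
     (\<Sum>m\<in>Poly_Mapping.keys f. of_nat (Poly_Mapping.lookup f m) * monom_eval \<alpha> m)"

definition nat_adjoin :: "nat \<Rightarrow> (nat \<Rightarrow> real) \<Rightarrow> real set" where
  "nat_adjoin n \<alpha> = nat_mpoly_eval \<alpha> ` nat_mpoly_in {1..n}"

lemma nat_mpoly_eval_superset:
  assumes "finite A" "Poly_Mapping.keys f \<subseteq> A"
  shows "nat_mpoly_eval \<alpha> f = (\<Sum>m\<in>A. of_nat (Poly_Mapping.lookup f m) * monom_eval \<alpha> m)"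
  unfolding nat_mpoly_eval_def
  by (rule sum.mono_neutral_left) (use assms in \<open>auto simp: in_keys_iff\<close>)

lemma monom_eval_superset:
  assumes "finite A" "Poly_Mapping.keys m \<subseteq> A"
  shows "monom_eval \<alpha> m = (\<Prod>i\<in>A. \<alpha> i ^ Poly_Mapping.lookup m i)"
  unfolding monom_eval_def
  by (rule prod.mono_neutral_left) (use assms in \<open>auto simp: in_keys_iff\<close>)

lemma monom_eval_add: "monom_eval \<alpha> (m + m') = monom_eval \<alpha> m * monom_eval \<alpha> m'"
proof -
  let ?A = "Poly_Mapping.keys m \<union> Poly_Mapping.keys m'"
  have "monom_eval \<alpha> (m + m') = (\<Prod>i\<in>?A. \<alpha> i ^ Poly_Mapping.lookup (m + m') i)"
    by (rule monom_eval_superset) (simp_all add: Poly_Mapping.keys_add)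
  also have "\<dots> = (\<Prod>i\<in>?A. \<alpha> i ^ Poly_Mapping.lookup m i) * (\<Prod>i\<in>?A. \<alpha> i ^ Poly_Mapping.lookup m' i)"
    by (simp add: lookup_add power_add prod.distrib)
  finally show ?thesis by (simp add: monom_eval_superset[of ?A])
qed

lemma nat_mpoly_eval_add: "nat_mpoly_eval \<alpha> (f + g) = nat_mpoly_eval \<alpha> f + nat_mpoly_eval \<alpha> g"
proof -
  let ?A = "Poly_Mapping.keys f \<union> Poly_Mapping.keys g"
  have "nat_mpoly_eval \<alpha> (f + g) =
      (\<Sum>m\<in>?A. of_nat (Poly_Mapping.lookup (f + g) m) * monom_eval \<alpha> m)"
    by (rule nat_mpoly_eval_superset) (simp_all add: Poly_Mapping.keys_add)
  then show ?thesis
    by (simp add: nat_mpoly_eval_superset[of ?A] lookup_add distrib_right sum.distrib)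
qed

lemma nat_mpoly_eval_single:
  "nat_mpoly_eval \<alpha> (Poly_Mapping.single m c) = of_nat c * monom_eval \<alpha> m"
  by (simp add: nat_mpoly_eval_def)

lemma update_eq_single_add:
  assumes "a \<notin> Poly_Mapping.keys (f :: 'a \<Rightarrow>\<^sub>0 nat)"
  shows "Poly_Mapping.update a b f = Poly_Mapping.single a b + f"
  by (rule poly_mapping_eqI)
     (use assms in \<open>auto simp: lookup_update lookup_add lookup_single in_keys_iff when_def\<close>)

lemma nat_mpoly_eval_mult: "nat_mpoly_eval \<alpha> (f * g) = nat_mpoly_eval \<alpha> f * nat_mpoly_eval \<alpha> g"
proof (induction f rule: update_induct)
  case const
  show ?case by (simp add: nat_mpoly_eval_def)
next
  case (update f a b)
  have "nat_mpoly_eval \<alpha> (Poly_Mapping.single a b * g) =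
      nat_mpoly_eval \<alpha> (Poly_Mapping.single a b) * nat_mpoly_eval \<alpha> g"
  proof (induction g rule: update_induct)
    case const
    show ?case by (simp add: nat_mpoly_eval_def)
  next
    case (update g c d)
    then show ?case
      by (simp add: update_eq_single_add distrib_left nat_mpoly_eval_add mult_single
          nat_mpoly_eval_single monom_eval_add)
  qed
  with update show ?case
    by (simp add: update_eq_single_add distrib_right nat_mpoly_eval_add)
qed

lemma positive_semidomain_nat_adjoin:
  assumes "\<And>i. i \<in> {1..n} \<Longrightarrow> \<alpha> i > 0"
  shows "positive_semidomain (nat_adjoin n \<alpha>)"
proof -
  have "nat_adjoin n \<alpha> \<subseteq> {0..}"
    unfolding nat_adjoin_def nat_mpoly_in_def nat_mpoly_eval_def monom_eval_def
    by (auto intro!: sum_nonneg mult_nonneg_nonneg prod_nonneg zero_le_power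
        less_imp_le[OF assms] simp del: atLeastAtMost_iff One_nat_def)
  moreover have "0 \<in> nat_adjoin n \<alpha>"
    unfolding nat_adjoin_def
    by (rule image_eqI[of _ _ 0]) (auto simp: nat_mpoly_in_def nat_mpoly_eval_def)
  moreover have "1 \<in> nat_adjoin n \<alpha>"
    unfolding nat_adjoin_def
    by (rule image_eqI[of _ _ 1])
       (auto simp: nat_mpoly_in_def nat_mpoly_eval_def monom_eval_def)
  moreover have "x + y \<in> nat_adjoin n \<alpha>" if xy: "x \<in> nat_adjoin n \<alpha>" "y \<in> nat_adjoin n \<alpha>" for x y
  proof -
    obtain f g where fg: "x = nat_mpoly_eval \<alpha> f" "y = nat_mpoly_eval \<alpha> g"
      "f \<in> nat_mpoly_in {1..n}" "g \<in> nat_mpoly_in {1..n}"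
      using xy unfolding nat_adjoin_def by blast
    then have "f + g \<in> nat_mpoly_in {1..n}"
      using Poly_Mapping.keys_add[of f g] unfolding nat_mpoly_in_def by blast
    then show ?thesis using fg unfolding nat_adjoin_def by (metis imageI nat_mpoly_eval_add)
  qed
  moreover have "x * y \<in> nat_adjoin n \<alpha>" if xy: "x \<in> nat_adjoin n \<alpha>" "y \<in> nat_adjoin n \<alpha>" for x y
  proof -
    obtain f g where fg: "x = nat_mpoly_eval \<alpha> f" "y = nat_mpoly_eval \<alpha> g"
      "f \<in> nat_mpoly_in {1..n}" "g \<in> nat_mpoly_in {1..n}"
      using xy unfolding nat_adjoin_def by blast
    have "Poly_Mapping.keys m \<subseteq> {1..n}" if m: "m \<in> Poly_Mapping.keys (f * g)" for m
    proof -
      obtain a b where "m = a + b" "a \<in> Poly_Mapping.keys f" "b \<in> Poly_Mapping.keys g"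
        using m Poly_Mapping.keys_mult[of f g] by blast
      then show ?thesis
        using fg(3,4) Poly_Mapping.keys_add[of a b] unfolding nat_mpoly_in_def by blast
    qed
    then have "f * g \<in> nat_mpoly_in {1..n}" by (simp add: nat_mpoly_in_def)
    then show ?thesis using fg unfolding nat_adjoin_def by (metis imageI nat_mpoly_eval_mult)
  qed
  ultimately show ?thesis by (simp add: positive_semidomain_def)
qed

end

theory Submission
  imports Defs
begin

text \<open>
  Unique additive factorization makes the additive atoms of \<open>S\<close> linearly independent over the
  rationals (\<open>independent_atoms\<close>). Since \<open>S\<close> is generated by finitely many algebraic numbers,
  it lies in a rational vector space of finite dimension, so it has only finitely many additive
  atoms. Consequently only finitely many elements of \<open>S\<close> lie below any given bound
  (\<open>finite_below\<close>); all nonzero elements are at least 1, and 1 is itself an atom.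

  Suppose that there is another atom \<open>b \<noteq> 1\<close>, and consider the real number \<open>f = N - b\<close> for
  a natural number \<open>N\<close>. It is never in \<open>S\<close>: an equation \<open>N = b + w\<close> would, since atoms are
  prime, make \<open>b\<close> a summand of 1 (\<open>atom_prime_of_nat_mult\<close>). On the other hand, when \<open>N\<close> is
  large, multiplication by \<open>f\<close> sends many elements of \<open>S\<close> into \<open>S\<close>. Let \<open>e\<close> be the sum of
  all atoms. Every element of \<open>S\<close> is an additive summand of a multiple of \<open>e\<close>, so any
  prescribed finite set of elements \<open>e + z\<close> with \<open>z \<in> S\<close> satisfies \<open>f (e + z) \<in> S\<close>
  for \<open>N\<close> large enough.

  Multiplicative unique factorization, through greatest common divisors, shows that the elements
  that \<open>f\<close> multiplies into \<open>S\<close> are exactly the multiples of a single \<open>d \<in> S\<close>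
  (\<open>multiplier_principal\<close>), the denominator of \<open>f\<close> in lowest terms. This \<open>d\<close> divides
  \<open>e\<close>, so \<open>d \<le> e\<close>, which leaves finitely many candidates. No \<open>d \<noteq> 1\<close> divides all the
  elements \<open>e + z\<close>, because there are more of them below a large bound than there are multiples
  of \<open>d\<close> (\<open>translate_not_multiples\<close>). So the finite set of \<open>z\<close> can be chosen to rule out
  every candidate except \<open>d = 1\<close>. Then \<open>f \<in> S\<close>, a contradiction. Hence 1 is the only atom,
  and \<open>S = \<nat>\<close>.
\<close>

section \<open>Finite-dimensional rational spaces containing algebraic numbers\<close>

interpretation rat_real: vector_space "\<lambda>(q::rat) (x::real). of_rat q * x"
  by unfold_locales (simp_all add: algebra_simps of_rat_add of_rat_mult)

lemma power_degree_in_span: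
  assumes "algebraic (b::real)"
  obtains D :: nat and q :: "nat \<Rightarrow> rat" where "D > 0" "b ^ D = (\<Sum>j<D. of_rat (q j) * b ^ j)"
proof -
  obtain p where p: "p \<noteq> 0" "poly (map_poly of_int p) b = 0"
    using algebraicE'[OF assms] by blast
  define D where "D = degree p"
  define c where "c = (real_of_int (coeff p D))"
  have c: "c \<noteq> 0" using p by (simp add: c_def D_def)
  have deg: "degree (map_poly real_of_int p) = D"
    unfolding D_def by (rule degree_map_poly) auto
  have *: "(\<Sum>i\<le>D. of_int (coeff p i) * b ^ i) = 0"
    using p(2) deg by (simp add: poly_altdef coeff_map_poly)
  have sp: "{..D} = insert D {..<D}" by auto
  have **: "c * b ^ D = - (\<Sum>i<D. of_int (coeff p i) * b ^ i)"
    using * unfolding sp by (simp add: c_def)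
  have D: "D > 0"
  proof (rule ccontr)
    assume "\<not> D > 0"
    then show False using ** c by simp
  qed
  have "b ^ D = (\<Sum>j<D. of_rat (- of_int (coeff p j) / of_int (coeff p D)) * b ^ j)"
  proof -
    have "b ^ D = (c * b ^ D) / c" using c by simp
    also have "\<dots> = (\<Sum>j<D. - (of_int (coeff p j) * b ^ j) / c)"
      by (simp add: ** sum_negf sum_divide_distrib)
    also have "\<dots> = (\<Sum>j<D. of_rat (- of_int (coeff p j) / of_int (coeff p D)) * b ^ j)"
      by (rule sum.cong) (auto simp: of_rat_divide of_rat_minus c_def)
    finally show ?thesis .
  qed
  then show ?thesis by (rule that[OF D])
qed

lemma span_closed_under_mult:
  assumes "\<And>t. t \<in> T \<Longrightarrow> b * t \<in> rat_real.span U" "x \<in> rat_real.span T"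
  shows "b * x \<in> rat_real.span U"
  using assms(2)
proof (induction rule: rat_real.span_induct_alt)
  case base
  then show ?case using rat_real.span_zero by simp
next
  case (step c x y)
  have "b * (of_rat c * x + y) = of_rat c * (b * x) + b * y" by (simp add: algebra_simps)
  then show ?case
    using step assms(1) rat_real.span_add rat_real.span_scale by metis
qed

text \<open>
  Instead of reducing monomials in several variables at once, the numbers are adjoined one by one.
  If \<open>b\<close> satisfies an equation of degree \<open>D\<close>, then multiplying the old spanning set by
  \<open>1, b, \<dots>, b ^ (D - 1)\<close> gives a space closed under multiplication by \<open>b\<close>, and the closure
  under the earlier numbers survives because multiplication commutes.
\<close>

lemma finite_span_closed_under_algebraic:
  assumes "finite B" "\<And>b. b \<in> B \<Longrightarrow> algebraic (b::real)"
  obtains T where "finite T" "1 \<in> rat_real.span T"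
    "\<And>b x. b \<in> B \<Longrightarrow> x \<in> rat_real.span T \<Longrightarrow> b * x \<in> rat_real.span T"
proof -
  have "\<exists>T. finite T \<and> 1 \<in> rat_real.span T \<and>
      (\<forall>b\<in>B. \<forall>x\<in>rat_real.span T. b * x \<in> rat_real.span T)"
    using assms
  proof (induction B rule: finite_induct)
    case empty
    show ?case by (rule exI[of _ "{1}"]) (auto intro: rat_real.span_base)
  next
    case (insert b B)
    then obtain T where T: "finite T" "1 \<in> rat_real.span T"
        "\<forall>c\<in>B. \<forall>x\<in>rat_real.span T. c * x \<in> rat_real.span T" by auto
    obtain D and q :: "nat \<Rightarrow> rat" where D: "D > 0" "b ^ D = (\<Sum>j<D. of_rat (q j) * b ^ j)"
      using power_degree_in_span insert.prems by blast
    define U where "U = {b ^ j * t | j t. j \<in> {..<D} \<and> t \<in> T}"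
    have U: "b ^ j * t \<in> rat_real.span U" if "j < D" "t \<in> T" for j t
      using that by (intro rat_real.span_base) (auto simp: U_def)
    have pow: "b ^ j * x \<in> rat_real.span U" if "j < D" "x \<in> rat_real.span T" for j x
      using span_closed_under_mult[OF U] that by blast
    have top: "b ^ D * t \<in> rat_real.span U" if t: "t \<in> T" for t
    proof -
      have "b ^ D * t = (\<Sum>j<D. of_rat (q j) * (b ^ j * t))"
        unfolding D(2) by (simp add: sum_distrib_right mult.assoc)
      then show ?thesis using U t
        by (auto intro!: rat_real.span_sum rat_real.span_scale)
    qed
    have mult_b: "b * u \<in> rat_real.span U" if "u \<in> U" for u
    proof -
      from that obtain j t where u: "u = b ^ j * t" "j < D" "t \<in> T" by (auto simp: U_def)
      then have eq: "b * u = b ^ Suc j * t" by simp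
      show ?thesis
      proof (cases "Suc j < D")
        case True
        then show ?thesis using U u eq by metis
      next
        case False
        then have "Suc j = D" using u by simp
        then show ?thesis using top u eq by metis
      qed
    qed
    have mult_B: "c * u \<in> rat_real.span U" if c: "c \<in> B" and u: "u \<in> U" for c u
    proof -
      from u obtain j t where u: "u = b ^ j * t" "j < D" "t \<in> T" by (auto simp: U_def)
      have "b ^ j * (c * t) \<in> rat_real.span U"
        using pow u T(3) c rat_real.span_base by blast
      then show ?thesis by (simp add: u mult.left_commute)
    qed
    have "c * u \<in> rat_real.span U" if "c \<in> insert b B" "u \<in> U" for c u
      using that(1) mult_b[OF that(2)] mult_B[OF _ that(2)] by (elim insertE) simp_all
    then have "\<forall>c\<in>insert b B. \<forall>x\<in>rat_real.span U. c * x \<in> rat_real.span U"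
      using span_closed_under_mult[where T = U and U = U] by meson
    moreover have "finite U" unfolding U_def using T(1) by (intro finite_image_set2) simp_all
    moreover have "1 \<in> rat_real.span U" using pow[OF D(1) T(2)] by simp
    ultimately show ?case by (intro exI[of _ U] conjI)
  qed
  then obtain T where T: "finite T" "1 \<in> rat_real.span T"
    "\<forall>b\<in>B. \<forall>x\<in>rat_real.span T. b * x \<in> rat_real.span T" by (elim exE conjE)
  show ?thesis by (rule that[OF T(1,2) T(3)[rule_format]])
qed

lemma nat_adjoin_subset_finite_span:
  assumes "\<And>i. i \<in> {1..n} \<Longrightarrow> algebraic (\<alpha> i)"
  obtains T where "finite T" "nat_adjoin n \<alpha> \<subseteq> rat_real.span T"
proof -
  obtain T where T: "finite T" "1 \<in> rat_real.span T"
    "\<And>b x. b \<in> \<alpha> ` {1..n} \<Longrightarrow> x \<in> rat_real.span T \<Longrightarrow> b * x \<in> rat_real.span T"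
    by (rule finite_span_closed_under_algebraic[of "\<alpha> ` {1..n}"]) (use assms in auto)
  have pow: "\<alpha> i ^ k * x \<in> rat_real.span T" if "i \<in> {1..n}" "x \<in> rat_real.span T" for i k x
    using that by (induction k) (auto simp: mult.assoc intro!: T(3))
  have prd: "(\<Prod>i\<in>I. \<alpha> i ^ g i) \<in> rat_real.span T" if "finite I" "I \<subseteq> {1..n}" for I and g :: "nat \<Rightarrow> nat"
    using that by (induction I rule: finite_induct) (auto intro: T(2) pow)
  have "nat_mpoly_eval \<alpha> f \<in> rat_real.span T" if f: "f \<in> nat_mpoly_in {1..n}" for f
    unfolding nat_mpoly_eval_def
  proof (rule rat_real.span_sum)
    fix m assume m: "m \<in> Poly_Mapping.keys f"
    then have "monom_eval \<alpha> m \<in> rat_real.span T"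
      using f unfolding monom_eval_def nat_mpoly_in_def by (intro prd) auto
    from rat_real.span_scale[OF this, of "of_nat (Poly_Mapping.lookup f m)"]
    show "of_nat (Poly_Mapping.lookup f m) * monom_eval \<alpha> m \<in> rat_real.span T"
      by simp
  qed
  then have "nat_adjoin n \<alpha> \<subseteq> rat_real.span T" unfolding nat_adjoin_def by (rule image_subsetI)
  then show ?thesis by (rule that[OF T(1)])
qed

section \<open>Additive factorization\<close>

locale additively_factorial =
  fixes S :: "real set"
  assumes semidomain: "positive_semidomain S"
    and factorial: "factorial_monoid (additive_monoid S)"
begin

sublocale add: factorial_monoid "additive_monoid S" by (rule factorial)

lemma add_simps [simp]:
  "carrier (additive_monoid S) = S" "mult (additive_monoid S) = (+)" "one (additive_monoid S) = 0"
  by (simp_all add: additive_monoid_def)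

lemma nonneg: "x \<in> S \<Longrightarrow> x \<ge> 0"
  and zero_mem [simp, intro]: "0 \<in> S"
  and one_mem [simp, intro]: "1 \<in> S"
  and add_mem [intro]: "x \<in> S \<Longrightarrow> y \<in> S \<Longrightarrow> x + y \<in> S"
  and mult_mem [intro]: "x \<in> S \<Longrightarrow> y \<in> S \<Longrightarrow> x * y \<in> S"
  using semidomain by (auto simp: positive_semidomain_def)

lemma of_nat_mem [simp, intro]: "of_nat k \<in> S"
  by (induction k) auto

lemma sum_mem [intro]: "(\<And>i. i \<in> I \<Longrightarrow> f i \<in> S) \<Longrightarrow> sum f I \<in> S"
  by (induction I rule: infinite_finite_induct) auto

lemma power_mem [intro]: "x \<in> S \<Longrightarrow> x ^ k \<in> S"
  by (induction k) auto

lemma add_divides_iff: "x divides\<^bsub>additive_monoid S\<^esub> y \<longleftrightarrow> (\<exists>z\<in>S. y = x + z)"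
  by (simp add: factor_def)

lemma add_Units [simp]: "Units (additive_monoid S) = {0}"
proof -
  have "x = 0" if "x \<in> S" "y \<in> S" "x + y = 0" for x y
    using that nonneg[of x] nonneg[of y] by linarith
  then show ?thesis by (auto simp: Units_def)
qed

definition atoms :: "real set" where
  "atoms = {a \<in> S. a \<noteq> 0 \<and> (\<forall>x\<in>S. \<forall>y\<in>S. a = x + y \<longrightarrow> x = 0 \<or> y = 0)}"

lemma atoms_iff: "a \<in> atoms \<longleftrightarrow> a \<in> S \<and> Divisibility.irreducible (additive_monoid S) a"
  using add.irreducible_iff_atom[of a] by (auto simp: atoms_def)

lemma atoms_subset: "atoms \<subseteq> S" by (auto simp: atoms_def)

lemma atoms_pos: "a \<in> atoms \<Longrightarrow> a > 0"
  using nonneg[of a] by (auto simp: atoms_def)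

lemma atom_dividesD:
  assumes "a \<in> atoms" "b \<in> atoms" "z \<in> S" "b = a + z"
  shows "a = b"
  using assms by (auto simp: atoms_def)

text \<open>
  The consequence of uniqueness of factorization through which it is used on the additive side.
\<close>

lemma atom_prime:
  assumes "a \<in> atoms" "x \<in> S" "y \<in> S" "z \<in> S" "x + y = a + z"
  shows "(\<exists>w\<in>S. x = a + w) \<or> (\<exists>w\<in>S. y = a + w)"
proof -
  have "Divisibility.prime (additive_monoid S) a"
    using assms(1) by (intro add.irreducible_prime) (auto simp: atoms_iff)
  then show ?thesis
    using assms(2-) unfolding Divisibility.prime_def by (auto simp: add_divides_iff)
qed

lemma atom_prime_of_nat_mult:
  assumes "a \<in> atoms" "x \<in> S" "z \<in> S" "of_nat k * x = a + z"
  shows "\<exists>w\<in>S. x = a + w"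
  using assms(3,4)
proof (induction k arbitrary: z)
  case 0
  then show ?case using atoms_pos[OF assms(1)] nonneg[of z] by simp
next
  case (Suc k)
  then show ?case
    using atom_prime[OF assms(1,2), of "of_nat k * x" z] assms(2)
    by (auto simp: algebra_simps)
qed

lemma atom_prime_sum:
  assumes "a \<in> atoms" "\<And>i. i \<in> I \<Longrightarrow> x i \<in> S" "z \<in> S" "sum x I = a + z"
  shows "\<exists>i\<in>I. \<exists>w\<in>S. x i = a + w"
  using assms(2-)
proof (induction I arbitrary: z rule: infinite_finite_induct)
  case (insert i I)
  have "x i + sum x I = a + z" using insert by simp
  then have "(\<exists>w\<in>S. x i = a + w) \<or> (\<exists>w\<in>S. sum x I = a + w)"
    using insert.prems by (intro atom_prime[OF assms(1)]) auto
  then show ?case using insert.IH insert.prems by blast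
qed (use atoms_pos[OF assms(1)] nonneg in \<open>force+\<close>)

lemma sum_of_atoms:
  assumes "x \<in> S"
  obtains as where "set as \<subseteq> atoms" "sum_list as = x"
proof -
  obtain as where as: "set as \<subseteq> S" "wfactors (additive_monoid S) as x"
    using add.wfactors_exist[of x] assms by auto
  have "foldr (+) as 0 \<sim>\<^bsub>additive_monoid S\<^esub> x"
    using as(2) by (simp add: wfactors_def)
  then obtain y z where yz: "y \<in> S" "z \<in> S" "x = foldr (+) as 0 + y" "foldr (+) as 0 = x + z"
    unfolding associated_def by (auto simp: add_divides_iff)
  then have "foldr (+) as 0 = x"
    using nonneg[of y] nonneg[of z] by linarith
  then have "sum_list as = x" by (simp add: sum_list.eq_foldr)
  moreover have "set as \<subseteq> atoms" using as by (auto simp: wfactors_def atoms_iff)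
  ultimately show ?thesis using that by blast
qed

text \<open>
  An atom that occurs on the left is a summand of the right-hand side, so by primeness it is a
  summand of, hence equal to, one of the atoms there.
\<close>

lemma disjoint_atom_combinations:
  assumes "finite F" "F \<subseteq> atoms" "finite G" "G \<subseteq> atoms" "F \<inter> G = {}"
    and "(\<Sum>a\<in>F. of_nat (k a) * a) = (\<Sum>a\<in>G. of_nat (l a) * a)"
    and a: "a \<in> F"
  shows "k a = 0"
proof (rule ccontr)
  assume "k a \<noteq> 0"
  then obtain k' where k': "k a = Suc k'" by (cases "k a") auto
  define z where "z = of_nat k' * a + (\<Sum>b\<in>F - {a}. of_nat (k b) * b)"
  have zS: "z \<in> S" unfolding z_def using assms(2) a atoms_subset by (intro add_mem mult_mem sum_mem) auto
  have "(\<Sum>b\<in>F. of_nat (k b) * b) = a + z"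
    using assms(1) a by (simp add: sum.remove[of F a] k' z_def algebra_simps)
  then have "(\<Sum>b\<in>G. of_nat (l b) * b) = a + z" using assms(6) by simp
  then obtain b w where b: "b \<in> G" "w \<in> S" "of_nat (l b) * b = a + w"
    using atom_prime_sum[of a G "\<lambda>b. of_nat (l b) * b" z] assms a zS atoms_subset by blast
  then obtain v where "v \<in> S" "b = a + v"
    using atom_prime_of_nat_mult[of a b w "l b"] assms a atoms_subset by blast
  then have "a = b" using atom_dividesD assms a b by blast
  then show False using assms(5) a b by blast
qed

text \<open>
  After clearing denominators, a linear relation between atoms has integer coefficients; moving
  the negative ones to the other side equates two combinations of disjoint sets of atoms.
\<close>

lemma independent_atoms: "rat_real.independent atoms"
  unfolding rat_real.independent_explicit_module
proof (intro allI impI)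
  fix t :: "real set" and u :: "real \<Rightarrow> rat" and v
  assume t: "finite t" "t \<subseteq> atoms" and s: "(\<Sum>v\<in>t. of_rat (u v) * v) = 0" and v: "v \<in> t"
  \<comment> \<open>a common denominator of the coefficients\<close>
  define d where "d = (\<Prod>a\<in>t. snd (quotient_of (u a)))"
  have d: "d > 0" unfolding d_def by (rule prod_pos) (use quotient_of_denom_pos' in auto)
  have "\<exists>c::int. of_int d * u a = of_int c" if "a \<in> t" for a
  proof -
    obtain p q where pq: "quotient_of (u a) = (p, q)" by fastforce
    have q: "q > 0" "u a = of_int p / of_int q"
      using pq quotient_of_denom_pos quotient_of_div by blast+
    have "q dvd d" unfolding d_def using dvd_prodI[OF t(1) that, of "\<lambda>a. snd (quotient_of (u a))"] pq by simp
    then obtain r where "d = q * r" by blast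
    then have "of_int d * u a = of_int (r * p)" using q by simp
    then show ?thesis by blast
  qed
  then obtain c :: "real \<Rightarrow> int" where c: "\<And>a. a \<in> t \<Longrightarrow> of_int d * u a = of_int (c a)" by metis
  have "(\<Sum>a\<in>t. of_int (c a) * a) = (\<Sum>a\<in>t. of_int d * (of_rat (u a) * a))"
  proof (rule sum.cong)
    fix a assume "a \<in> t"
    from arg_cong[OF c[OF this], of "of_rat :: rat \<Rightarrow> real"]
    show "of_int (c a) * a = of_int d * (of_rat (u a) * a)" by (simp add: of_rat_mult)
  qed simp
  also have "\<dots> = 0" using s by (simp flip: sum_distrib_left)
  finally have c0: "(\<Sum>a\<in>t. of_int (c a) * a) = 0" .
  define F where "F = {a \<in> t. c a > 0}"
  define G where "G = {a \<in> t. c a \<le> 0}"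
  have fin: "finite F" "finite G" "F \<inter> G = {}" "t = F \<union> G" "F \<subseteq> atoms" "G \<subseteq> atoms"
    using t by (auto simp: F_def G_def)
  have "(\<Sum>a\<in>F. of_int (c a) * a) + (\<Sum>a\<in>G. of_int (c a) * a) = 0"
    using c0 fin by (simp add: sum.union_disjoint)
  moreover have "(\<Sum>a\<in>F. of_int (c a) * a) = (\<Sum>a\<in>F. of_nat (nat (c a)) * a)"
    by (rule sum.cong) (auto simp: F_def)
  moreover have "(\<Sum>a\<in>G. of_int (c a) * a) = - (\<Sum>a\<in>G. of_nat (nat (- c a)) * a)"
    unfolding sum_negf[symmetric] by (rule sum.cong) (auto simp: G_def)
  ultimately have eq: "(\<Sum>a\<in>F. of_nat (nat (c a)) * a) = (\<Sum>a\<in>G. of_nat (nat (- c a)) * a)"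
    by simp
  have "c v = 0"
  proof (cases "v \<in> F")
    case True
    have "nat (c v) = 0"
      by (rule disjoint_atom_combinations[OF fin(1,5,2,6,3) eq True])
    then show ?thesis using True by (simp add: F_def)
  next
    case False
    then have vG: "v \<in> G" using v fin by blast
    have "nat (- c v) = 0"
      by (rule disjoint_atom_combinations[OF fin(2,6,1,5) _ eq[symmetric] vG]) (use fin in blast)
    then show ?thesis using vG by (simp add: G_def)
  qed
  then show "u v = 0" using c[OF v] d by simp
qed

lemma finite_atoms_if_finite_span:
  assumes "finite T" "S \<subseteq> rat_real.span T"
  shows "finite atoms"
  using rat_real.independent_span_bound[OF assms(1) independent_atoms] assms(2) atoms_subset by blast

end

section \<open>Finitely many additive atoms\<close>

locale finitely_additively_factorial = additively_factorial +
  assumes finite_atoms: "finite atoms"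
begin

lemma atom_coordinates:
  assumes "x \<in> S"
  obtains k :: "real \<Rightarrow> nat" where "x = (\<Sum>a\<in>atoms. of_nat (k a) * a)"
proof -
  obtain as where as: "set as \<subseteq> atoms" "sum_list as = x" using sum_of_atoms assms by blast
  from as(1) have "sum_list as = (\<Sum>a\<in>atoms. of_nat (count_list as a) * a)"
  proof (induction as)
    case (Cons b as)
    have "(\<Sum>a\<in>atoms. of_nat (count_list (b # as) a) * a) =
        (\<Sum>a\<in>atoms. (if a = b then a else 0) + of_nat (count_list as a) * a)"
      by (rule sum.cong) (auto simp: algebra_simps)
    then show ?case using Cons finite_atoms by (simp add: sum.distrib)
  qed simp
  then show ?thesis using that as by simp
qed

text \<open>
  The atoms are finitely many positive numbers, so a bound on a sum bounds every coefficient.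
\<close>

lemma finite_below: "finite {x \<in> S. x \<le> X}"
proof (rule finite_subset)
  let ?f = "\<lambda>k. \<Sum>a\<in>atoms. real (k a) * a"
  let ?P = "Pi\<^sub>E atoms (\<lambda>a. {..nat \<lfloor>X / a\<rfloor>})"
  show "finite (?f ` ?P)" using finite_atoms by (intro finite_imageI finite_PiE) auto
  show "{x \<in> S. x \<le> X} \<subseteq> ?f ` ?P"
  proof
    fix x assume x: "x \<in> {x \<in> S. x \<le> X}"
    then obtain k :: "real \<Rightarrow> nat" where k: "x = ?f k" using atom_coordinates by blast
    have "restrict k atoms \<in> ?P"
    proof (rule restrict_PiE_iff[THEN iffD2], rule ballI)
      fix a assume a: "a \<in> atoms"
      have "real (k a) * a \<le> ?f k"
        using finite_atoms a atoms_pos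
        by (intro member_le_sum mult_nonneg_nonneg) (auto intro: less_imp_le)
      then have "real (k a) \<le> X / a" using x k atoms_pos[OF a] by (simp add: field_simps)
      then show "k a \<in> {..nat \<lfloor>X / a\<rfloor>}" by (simp add: le_nat_floor)
    qed
    moreover have "x = ?f (restrict k atoms)" using k by simp
    ultimately show "x \<in> ?f ` ?P" by blast
  qed
qed

text \<open>
  The powers of an element strictly between 0 and 1 would be infinitely many elements below 1.
\<close>

lemma ge_one:
  assumes "x \<in> S" "x \<noteq> 0"
  shows "x \<ge> 1"
proof (rule ccontr)
  assume "\<not> x \<ge> 1"
  then have x: "0 < x" "x < 1" using nonneg assms by force+
  have "inj (\<lambda>k. x ^ k)"
    using x by (intro injI) (metis linorder_neqE_nat power_strict_decreasing order_less_irrefl)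
  moreover have "range (\<lambda>k. x ^ k) \<subseteq> {y \<in> S. y \<le> 1}"
    using x assms by (auto intro: power_le_one)
  ultimately show False
    using finite_below[of 1] finite_imageD infinite_UNIV_nat finite_subset by blast
qed

lemma one_atom: "1 \<in> atoms"
proof -
  have "x = 0 \<or> y = 0" if "x \<in> S" "y \<in> S" "1 = x + y" for x y
    using that ge_one[of x] ge_one[of y] by fastforce
  then show ?thesis by (auto simp: atoms_def)
qed

text \<open>
  If \<open>d > 1\<close> divided every \<open>e + z\<close>, then \<open>z \<mapsto> (e + z) / d\<close> would be an injection of \<open>S\<close>
  into itself that decreases all large elements. For a large bound \<open>Y\<close> it would map the finite
  set of elements up to \<open>Y\<close> into the same set without \<open>Y\<close>.
\<close>

lemma translate_not_multiples:
  assumes "e \<in> S" "d \<in> S" "d \<noteq> 0" "d \<noteq> 1"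
  shows "\<exists>z\<in>S. \<not> (\<exists>y\<in>S. e + z = d * y)"
proof (rule ccontr)
  assume "\<not> ?thesis"
  then have all: "\<And>z. z \<in> S \<Longrightarrow> \<exists>y\<in>S. e + z = d * y" by blast
  have d: "d > 1" using ge_one[of d] assms by force
  \<comment> \<open>the map fixes \<open>e / (d - 1)\<close> and decreases everything above it\<close>
  obtain Y :: nat where Y: "real Y > e / (d - 1)" using reals_Archimedean2 by blast
  let ?B = "{z \<in> S. z \<le> real Y}"
  have eY: "e + real Y < d * real Y" using Y d by (simp add: field_simps)
  have "(\<lambda>z. (e + z) / d) ` ?B \<subseteq> ?B - {real Y}"
  proof
    fix y assume "y \<in> (\<lambda>z. (e + z) / d) ` ?B"
    then obtain z where z: "z \<in> S" "z \<le> real Y" "y = (e + z) / d" by blast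
    have "e + z < d * real Y" using z(2) eY by linarith
    then have "y < real Y" using d by (simp add: z(3) divide_less_eq mult.commute)
    moreover have "y \<in> S" using all[OF z(1)] z(3) d by auto
    ultimately show "y \<in> ?B - {real Y}" by auto
  qed
  moreover have "inj_on (\<lambda>z. (e + z) / d) ?B" using d by (auto simp: inj_on_def)
  ultimately have "card ?B \<le> card (?B - {real Y})"
    using finite_below card_inj_on_le by blast
  moreover have "real Y \<in> ?B" by simp
  then have "card (?B - {real Y}) < card ?B"
    using finite_below[of "real Y"] by (meson card_Diff1_less)
  ultimately show False by simp
qed

text \<open>
  Every atom occurs in the sum of all atoms, so a large multiple of that sum dominates the
  coefficients of any given element.
\<close>

lemma sum_atoms_absorbs:
  assumes "x \<in> S"
  obtains N :: nat where "\<And>M. M \<ge> N \<Longrightarrow> real M * \<Sum>atoms - x \<in> S"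
proof -
  obtain k :: "real \<Rightarrow> nat" where k: "x = (\<Sum>a\<in>atoms. of_nat (k a) * a)"
    using atom_coordinates assms by blast
  show ?thesis
  proof (rule that)
    fix M assume M: "M \<ge> (\<Sum>a\<in>atoms. k a)"
    have "real M * \<Sum>atoms - x = (\<Sum>a\<in>atoms. of_nat (M - k a) * a)"
    proof -
      have "k a \<le> M" if "a \<in> atoms" for a
        using M member_le_sum[OF that, of k] finite_atoms by simp
      then show ?thesis
        unfolding k sum_distrib_left sum_subtractf[symmetric]
        by (intro sum.cong) (auto simp: of_nat_diff algebra_simps)
    qed
    then show "real M * \<Sum>atoms - x \<in> S" using atoms_subset by auto
  qed
qed

end

section \<open>Multiplicative factorization\<close>

text \<open>
  In fraction notation, \<open>d\<close> is the denominator of \<open>b / a\<close> in lowest terms: with \<open>h\<close> a greatest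
  common divisor of \<open>a\<close> and \<open>b\<close>, it is \<open>a / h\<close>. If \<open>a\<close> divides \<open>b x\<close>, then it divides the
  greatest common divisor \<open>x h\<close> of \<open>a x\<close> and \<open>b x\<close>, and cancelling \<open>h\<close> gives the claim.
\<close>

lemma (in gcd_condition_monoid) colon_principal:
  assumes "a \<in> carrier G" "b \<in> carrier G"
  obtains d where "d \<in> carrier G" "\<And>x. x \<in> carrier G \<Longrightarrow> a divides (b \<otimes> x) \<longleftrightarrow> d divides x"
proof -
  define h where "h = somegcd G a b"
  have h: "h \<in> carrier G" unfolding h_def using assms by simp
  have "h divides a" "h divides b" unfolding h_def using assms by (simp_all add: gcd_divides_l gcd_divides_r)
  then obtain d c where d: "d \<in> carrier G" "a = h \<otimes> d" and c: "c \<in> carrier G" "b = h \<otimes> c"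
    by (auto elim!: dividesE)
  show ?thesis
  proof (rule that[OF d(1)])
    fix x assume x: "x \<in> carrier G"
    show "a divides (b \<otimes> x) \<longleftrightarrow> d divides x"
    proof
      assume "a divides (b \<otimes> x)"
      then have "a divides (x \<otimes> b)" using x assms by (simp add: m_comm)
      moreover have "a divides (x \<otimes> a)" using x assms by (metis divides_prod_l divides_refl)
      ultimately have "a divides somegcd G (x \<otimes> a) (x \<otimes> b)"
        using x assms by (intro gcd_divides) auto
      moreover have "somegcd G (x \<otimes> a) (x \<otimes> b) \<sim> x \<otimes> h"
        unfolding h_def using gcd_mult[of a b x] x assms by (simp add: associated_sym)
      ultimately have "a divides (x \<otimes> h)"
        using x assms h divides_cong_r by (meson gcd_closed m_closed)
      then have "h \<otimes> d divides (h \<otimes> x)" using d x h by (simp add: m_comm)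
      then show "d divides x" using d x h divides_mult_l by blast
    next
      assume "d divides x"
      then obtain y where y: "y \<in> carrier G" "x = d \<otimes> y" by (auto elim: dividesE)
      have "b \<otimes> x = a \<otimes> (c \<otimes> y)"
        using c d h y by (simp add: m_ac)
      then show "a divides (b \<otimes> x)" using c y by (auto intro: dividesI)
    qed
  qed
qed

text \<open>
  The element \<open>e\<close> witnesses that \<open>f\<close> is the quotient of \<open>f e\<close> by \<open>e\<close>, both nonzero elements of
  \<open>S\<close>. Hence \<open>f x \<in> S\<close> means that \<open>e\<close> divides \<open>(f e) x\<close>, and these \<open>x\<close> are the
  multiples of one element.
\<close>

lemma multiplier_principal:
  assumes "factorial_monoid (multiplicative_monoid S)"
    and "e \<in> S - {0}" "f * e \<in> S - {0}"
  obtains d where "d \<in> S - {0}" "f * d \<in> S"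
    "\<And>x. x \<in> S - {0} \<Longrightarrow> f * x \<in> S \<Longrightarrow> \<exists>y\<in>S. x = d * y"
proof -
  interpret m: factorial_monoid "multiplicative_monoid S" by fact
  have simps [simp]: "carrier (multiplicative_monoid S) = S - {0}"
    "mult (multiplicative_monoid S) = (*)"
    by (simp_all add: multiplicative_monoid_def)
  have dvd: "x divides\<^bsub>multiplicative_monoid S\<^esub> y \<longleftrightarrow> (\<exists>z\<in>S - {0}. y = x * z)" for x y
    by (simp add: factor_def)
  have carr: "e \<in> carrier (multiplicative_monoid S)" "f * e \<in> carrier (multiplicative_monoid S)"
    using assms(2,3) by simp_all
  obtain d where d: "d \<in> S - {0}" and iff: "\<And>x. x \<in> S - {0} \<Longrightarrow>
      (\<exists>z\<in>S - {0}. f * e * x = e * z) \<longleftrightarrow> (\<exists>z\<in>S - {0}. x = d * z)"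
    using m.colon_principal[OF carr, unfolded simps dvd, of thesis] by blast
  have "(\<exists>z\<in>S - {0}. f * e * x = e * z) \<longleftrightarrow> f * x \<in> S" if "x \<in> S - {0}" for x
  proof -
    have "f * e * x = e * z \<longleftrightarrow> z = f * x" for z using assms(2) by auto
    then show ?thesis using that assms(3) by auto
  qed
  then have iff': "f * x \<in> S \<longleftrightarrow> (\<exists>z\<in>S - {0}. x = d * z)" if "x \<in> S - {0}" for x
    using iff that by blast
  have "\<exists>z\<in>S - {0}. d = d * z"
    using m.one_closed by (intro bexI[of _ 1]) (auto simp: multiplicative_monoid_def)
  then have "f * d \<in> S" using iff'[OF d] by blast
  then show ?thesis using that[OF d] iff' by blast
qed

section \<open>The only additive atom is one\<close>

context finitely_additively_factorial
begin

text \<open>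
  Both factorization properties meet here. For an atom \<open>b \<noteq> 1\<close> the multiplier
  \<open>f = N - b\<close> sends enough elements of \<open>S\<close> into \<open>S\<close> to force its denominator to be 1, whereas
  primeness of \<open>b\<close> keeps \<open>f\<close> outside \<open>S\<close>.
\<close>

lemma atom_eq_one:
  assumes mult: "factorial_monoid (multiplicative_monoid S)" and b: "b \<in> atoms"
  shows "b = 1"
proof (rule ccontr)
  assume b1: "b \<noteq> 1"
  have bS: "b \<in> S" using b atoms_subset by blast
  define e where "e = \<Sum>atoms"
  have eS: "e \<in> S" unfolding e_def using atoms_subset by auto
  have "1 \<le> e" unfolding e_def
    using member_le_sum[OF one_atom, of "\<lambda>x. x"] finite_atoms atoms_pos by (auto intro: less_imp_le)
  then have e0: "e > 0" by simp
  \<comment> \<open>contains all divisors of \<open>e\<close> other than 1, as cofactors are at least 1\<close>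
  define D where "D = {d \<in> S. d \<le> e} - {0, 1}"
  have finD: "finite D" unfolding D_def using finite_below by blast
  have "\<exists>z\<in>S. \<not> (\<exists>y\<in>S. e + z = d * y)" if "d \<in> D" for d
    using translate_not_multiples[OF eS, of d] that by (auto simp: D_def)
  then obtain z where z: "\<And>d. d \<in> D \<Longrightarrow> z d \<in> S" "\<And>d. d \<in> D \<Longrightarrow> \<not> (\<exists>y\<in>S. e + z d = d * y)"
    by metis
  define Z where "Z = insert 0 (z ` D)"
  have Z: "finite Z" "Z \<subseteq> S" using finD z by (auto simp: Z_def)
  have "\<exists>N::nat. \<forall>M\<ge>N. real M * e - b * (e + w) \<in> S" if "w \<in> S" for w
    using sum_atoms_absorbs[of "b * (e + w)"] bS eS that unfolding e_def by (metis add_mem mult_mem)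
  then obtain K :: "real \<Rightarrow> nat" where K:
      "\<And>w M. w \<in> S \<Longrightarrow> M \<ge> K w \<Longrightarrow> real M * e - b * (e + w) \<in> S" by metis
  \<comment> \<open>\<open>N\<close> exceeds \<open>b\<close> and, being a sum, every one of the thresholds \<open>K w\<close>\<close>
  obtain N0 :: nat where N0: "real N0 > b" using reals_Archimedean2 by blast
  define N where "N = N0 + (\<Sum>w\<in>Z. K w)"
  define f where "f = real N - b"
  have f0: "f > 0" using less_le_trans[OF N0, of "real N"] by (simp add: f_def N_def sum_nonneg)
  have fZ: "f * (e + w) \<in> S" if w: "w \<in> Z" for w
  proof -
    have "K w \<le> N" unfolding N_def using member_le_sum[OF w, of K] Z by simp
    then have "real N * e - b * (e + w) \<in> S" using K w Z by blast
    moreover have "f * (e + w) = (real N * e - b * (e + w)) + real N * w"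
      by (simp add: f_def algebra_simps)
    ultimately show ?thesis using w Z by (metis add_mem mult_mem of_nat_mem subsetD)
  qed
  have "f * e \<in> S - {0}" using fZ[of 0] f0 e0 by (simp add: Z_def)
  then obtain d where d: "d \<in> S - {0}" "f * d \<in> S"
      and dvd: "\<And>x. x \<in> S - {0} \<Longrightarrow> f * x \<in> S \<Longrightarrow> \<exists>y\<in>S. x = d * y"
    using multiplier_principal[OF mult, of e f] eS e0 by auto
  have dvdZ: "\<exists>y\<in>S. e + w = d * y" if "w \<in> Z" for w
  proof (rule dvd)
    have "w \<ge> 0" using that Z nonneg by blast
    then show "e + w \<in> S - {0}" using eS e0 that Z by auto
  qed (use fZ that in blast)
  have "d = 1"
  proof (rule ccontr)
    assume d1: "d \<noteq> 1"
    obtain y where y: "y \<in> S" "e = d * y" using dvdZ[of 0] by (auto simp: Z_def)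
    then have "y \<ge> 1" using ge_one[of y] e0 by force
    then have "d \<le> e" using y d nonneg[of d] by (simp add: mult_le_cancel_left1)
    then have "d \<in> D" using d d1 by (auto simp: D_def)
    then show False using z(2) dvdZ[of "z d"] by (auto simp: Z_def)
  qed
  then have "f \<in> S" using d by simp
  then obtain w where "w \<in> S" "1 = b + w"
    using atom_prime_of_nat_mult[OF b one_mem, of f N] by (auto simp: f_def)
  then show False using atom_dividesD[OF b one_atom] b1 by blast
qed

lemma eq_Nats:
  assumes "factorial_monoid (multiplicative_monoid S)"
  shows "S = \<nat>"
proof
  have atoms: "atoms = {1}" using atom_eq_one[OF assms] one_atom by blast
  show "S \<subseteq> \<nat>"
  proof
    fix x assume "x \<in> S"
    then obtain k :: "real \<Rightarrow> nat" where "x = (\<Sum>a\<in>atoms. of_nat (k a) * a)"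
      using atom_coordinates by blast
    then show "x \<in> \<nat>" by (simp add: atoms)
  qed
  show "\<nat> \<subseteq> S" by (auto elim: Nats_cases)
qed

end

theorem theorem5p7:
  fixes n :: nat and \<alpha> :: "nat \<Rightarrow> real"
  assumes "n \<ge> 1"
    and "\<And>i. i \<in> {1..n} \<Longrightarrow> \<alpha> i > 0"
    and "\<And>i. i \<in> {1..n} \<Longrightarrow> algebraic (\<alpha> i)"
    and "bi_UFS (nat_adjoin n \<alpha>)"
  shows "nat_adjoin n \<alpha> = \<nat>"
proof -
  interpret additively_factorial "nat_adjoin n \<alpha>"
    using assms(4) by (simp add: bi_UFS_def additively_factorial.intro)
  obtain T where "finite T" "nat_adjoin n \<alpha> \<subseteq> rat_real.span T"
    using nat_adjoin_subset_finite_span assms(3) by blast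
  then interpret finitely_additively_factorial "nat_adjoin n \<alpha>"
    by unfold_locales (rule finite_atoms_if_finite_span)
  show ?thesis using eq_Nats assms(4) by (simp add: bi_UFS_def)
qed

end
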